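(* Let $A\in\mathbb{R}^{m\times n}$, let $f:\mathbb{R}^m\to\mathbb{R}$ and $g:\mathbb{R}^n\to\mathbb{R}\cup\{+\infty\}$ be proper, closed and convex, and let $\alpha>0$ be such that $f$ is differentiable on $\mathbb{R}^m$ with $\|\nabla f(z)-\nabla f(z')\|_2\le \alpha^{-1}\|z-z'\|_2$ for all $z,z'\in\mathbb{R}^m$. Let $P(x)=f(Ax)+g(x)$ and $D(u)=-f^*(-u)-g^*(A^{\top}u)$, and assume $P$ has at least one minimizer over $\mathbb{R}^n$. Let $u^\star$ be the (unique) maximizer of $D$ over $\mathbb{R}^m$. Then for every $(x,u)\in\mathrm{dom}(P)\times\mathrm{dom}(-D)$, $$u^\star\in \mathcal{B}(c_{\mathrm{RYU}},r_{\mathrm{RYU}}),$$ where $$c_{\mathrm{RYU}}=\tfrac12\bigl(u-\nabla f(Ax)\bigr),\qquad r_{\mathrm{RYU}}=\sqrt{\frac{P(x)-D(u)}{\alpha}-\frac{\|u+\nabla f(Ax)\|_2^2}{4}}.$$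
   Context: $h^*(z^* )=\sup_z \langle z^*,z\rangle-h(z)$ denotes the convex conjugate of $h$, and $\mathrm{dom}(h)=\{z: h(z)<+\infty\}$. $\mathcal{B}(c,r)=\{u\in\mathbb{R}^m:\|u-c\|_2\le r\}$ is the closed Euclidean ball with center $c$ and radius $r\ge 0$. Under the stated assumptions the maximizer $u^\star$ of $D$ exists and is unique, and the quantity under the square root is nonnegative for every $(x,u)\in\mathrm{dom}(P)\times\mathrm{dom}(-D)$. *)

theory Defs
  imports "HOL-Analysis.Analysis"
begin

text \<open>
  Functions into the extended reals are handled through their (real-height) epigraph. The library's
  \<^const>\<open>epigraph\<close> and \<^const>\<open>convex_on\<close> only cover real-valued functions.
\<close>

definition ext_epigraph :: "('a \<Rightarrow> ereal) \<Rightarrow> ('a \<times> real) set" where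
  "ext_epigraph h = {(z, t). h z \<le> ereal t}"

definition eff_dom :: "('a \<Rightarrow> ereal) \<Rightarrow> 'a set" where
  "eff_dom h = {z. h z < \<infinity>}"

definition proper_fun :: "('a \<Rightarrow> ereal) \<Rightarrow> bool" where
  "proper_fun h \<longleftrightarrow> (\<forall>z. h z \<noteq> -\<infinity>) \<and> eff_dom h \<noteq> {}"

definition closed_fun :: "('a::topological_space \<Rightarrow> ereal) \<Rightarrow> bool" where
  "closed_fun h \<longleftrightarrow> closed (ext_epigraph h)"

definition convex_fun :: "('a::real_vector \<Rightarrow> ereal) \<Rightarrow> bool" where
  "convex_fun h \<longleftrightarrow> convex (ext_epigraph h)"

definition conjugate :: "('a::real_inner \<Rightarrow> ereal) \<Rightarrow> 'a \<Rightarrow> ereal" where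
  "conjugate h zs = (SUP z. ereal (inner zs z) - h z)"

definition primal :: "real^'n^'m \<Rightarrow> (real^'m \<Rightarrow> real) \<Rightarrow> (real^'n \<Rightarrow> ereal) \<Rightarrow> real^'n \<Rightarrow> ereal" where
  "primal A f g x = ereal (f (A *v x)) + g x"

text \<open>
  For proper \<open>g\<close> both conjugates below are different from \<open>-\<infinity>\<close>, so the undetermined form
  \<open>\<infinity> - \<infinity>\<close> does not occur.
\<close>

definition dual :: "real^'n^'m \<Rightarrow> (real^'m \<Rightarrow> real) \<Rightarrow> (real^'n \<Rightarrow> ereal) \<Rightarrow> real^'m \<Rightarrow> ereal" where
  "dual A f g u = - conjugate (\<lambda>z. ereal (f z)) (- u) - conjugate g (transpose A *v u)"

end

theory Submission
  imports Defs
begin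

text \<open>
  Let \<open>xs\<close> minimize \<open>P\<close>. First-order optimality at \<open>xs\<close> shows that \<open>us = - gradf (A xs)\<close> satisfies
  \<open>D us = P xs\<close>. The descent lemma for the \<open>1/\<alpha>\<close>-smooth function \<open>f\<close> strengthens the gradient
  inequality (co-coercivity) and the Fenchel-Young inequality, giving
  \<open>P x - P xs \<ge> \<alpha>/2 \<parallel>us + gradf (A x)\<parallel>\<^sup>2\<close> and \<open>D us - D u \<ge> \<alpha>/2 \<parallel>us - u\<parallel>\<^sup>2\<close>. The latter makes
  \<open>us\<close> the unique maximizer; the sum of both is the claimed ball by the parallelogram law.
\<close>

section \<open>Convexity and derivatives along segments\<close>

lemma convex_fun_ereal_le:
  assumes "convex_fun h" "h x \<le> ereal a" "h y \<le> ereal b" "0 \<le> t" "t \<le> 1"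
  shows "h ((1 - t) *\<^sub>R x + t *\<^sub>R y) \<le> ereal ((1 - t) * a + t * b)"
proof -
  have "(1 - t) *\<^sub>R (x, a) + t *\<^sub>R (y, b) \<in> ext_epigraph h"
    using assms unfolding convex_fun_def by (intro convexD) (auto simp: ext_epigraph_def)
  then show ?thesis by (simp add: ext_epigraph_def)
qed

lemma GDERIV_along_line:
  assumes "GDERIV f (z + t *\<^sub>R d) :> D"
  shows "((\<lambda>s. f (z + s *\<^sub>R d)) has_real_derivative inner D d) (at t)"
proof -
  have "(f has_derivative (\<lambda>h. inner h D)) (at (z + t *\<^sub>R d))"
    using assms by (simp add: gderiv_def)
  then have "((\<lambda>s. f (z + s *\<^sub>R d)) has_derivative (\<lambda>s. inner (s *\<^sub>R d) D)) (at t)"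
    by (rule has_derivative_compose[rotated]) (auto intro!: derivative_eq_intros)
  moreover have "(\<lambda>s. inner (s *\<^sub>R d) D) = (*) (inner D d)"
    by (auto simp: inner_commute)
  ultimately show ?thesis by (simp add: has_field_derivative_def)
qed

text \<open>A negative derivative would make \<open>\<phi>\<close> drop immediately to the right of
  0. The one-sided form fits functions that convexity controls only on a segment starting at the
  point of interest.\<close>

lemma DERIV_nonneg_at_right_min:
  fixes \<phi> :: "real \<Rightarrow> real"
  assumes "(\<phi> has_real_derivative l) (at 0)" "\<And>t. 0 < t \<Longrightarrow> t \<le> 1 \<Longrightarrow> \<phi> 0 \<le> \<phi> t"
  shows "0 \<le> l"
proof (rule ccontr)
  assume "\<not> 0 \<le> l"
  then obtain e where e: "e > 0" "\<And>h. h > 0 \<Longrightarrow> h < e \<Longrightarrow> \<phi> (0 + h) < \<phi> 0"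
    using DERIV_neg_dec_right[OF assms(1)] by auto
  define t where "t = min 1 (e / 2)"
  have "0 < t" "t \<le> 1" "t < e" using e(1) by (auto simp: t_def)
  then show False using e(2)[of t] assms(2)[of t] by simp
qed

text \<open>The gap between the chord and \<open>f\<close> along the segment vanishes at
  \<open>z\<close> and is nonnegative afterwards, so its slope at \<open>z\<close> is
  nonnegative.\<close>

lemma convex_fun_gradient_ineq:
  fixes f :: "'a::real_inner \<Rightarrow> real"
  assumes "convex_fun (\<lambda>z. ereal (f z))" "GDERIV f z :> D"
  shows "f z + inner D (y - z) \<le> f y"
proof -
  let ?\<phi> = "\<lambda>t. t * (f y - f z) - (f (z + t *\<^sub>R (y - z)) - f z)"
  have "0 \<le> (f y - f z) - inner D (y - z)"
  proof (rule DERIV_nonneg_at_right_min)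
    have "((\<lambda>t. f (z + t *\<^sub>R (y - z))) has_real_derivative inner D (y - z)) (at 0)"
      using assms(2) by (intro GDERIV_along_line) simp
    then show "(?\<phi> has_real_derivative (f y - f z) - inner D (y - z)) (at 0)"
      by (auto intro!: derivative_eq_intros)
  next
    fix t :: real
    assume t: "0 < t" "t \<le> 1"
    have "f ((1 - t) *\<^sub>R z + t *\<^sub>R y) \<le> (1 - t) * f z + t * f y"
      using convex_fun_ereal_le[OF assms(1), of z "f z" y "f y" t] t by simp
    then show "?\<phi> 0 \<le> ?\<phi> t" by (simp add: algebra_simps)
  qed
  then show ?thesis by simp
qed

section \<open>Quadratic bounds from a Lipschitz gradient\<close>

lemma descent_lemma:
  fixes f :: "'a::real_inner \<Rightarrow> real"
  assumes G: "\<And>z. GDERIV f z :> gradf z"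
    and L: "\<And>z z'. norm (gradf z - gradf z') \<le> L * norm (z - z')"
  shows "f y \<le> f z + inner (gradf z) (y - z) + L / 2 * (norm (y - z))\<^sup>2"
proof -
  define d where "d = y - z"
  \<comment> \<open>Up to the constant \<open>f z\<close>, this is \<open>f\<close> minus its
    quadratic upper model along the segment. It is nonincreasing, because at time \<open>t\<close>
    the gradient has moved by at most \<open>L * t * norm d\<close>.\<close>
  let ?h = "\<lambda>t. f (z + t *\<^sub>R d) - t * inner (gradf z) d - t\<^sup>2 * (L / 2 * (norm d)\<^sup>2)"
  have "?h 1 \<le> ?h 0"
  proof (rule DERIV_nonpos_imp_nonincreasing[where f = ?h])
    fix t :: real
    assume t: "0 \<le> t" "t \<le> 1"
    have D: "(?h has_real_derivative
        inner (gradf (z + t *\<^sub>R d)) d - inner (gradf z) d - t * (L * (norm d)\<^sup>2)) (at t)"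
      by (auto intro!: derivative_eq_intros GDERIV_along_line G)
    have "inner (gradf (z + t *\<^sub>R d)) d - inner (gradf z) d
        \<le> norm (gradf (z + t *\<^sub>R d) - gradf z) * norm d"
      by (metis inner_diff_left norm_cauchy_schwarz)
    also have "\<dots> \<le> (L * norm (t *\<^sub>R d)) * norm d"
      using L[of "z + t *\<^sub>R d" z] by (intro mult_right_mono) auto
    also have "\<dots> = t * (L * (norm d)\<^sup>2)"
      using t by (simp add: power2_eq_square)
    finally show "\<exists>y. (?h has_real_derivative y) (at t) \<and> y \<le> 0"
      using D diff_le_0_iff_le by blast
  qed simp
  then show ?thesis by (simp add: d_def)
qed

text \<open>The value of \<open>f\<close> at a trial point is bounded below by the tangent at
  \<open>z\<close> and above by the descent lemma at \<open>y\<close>. The trial point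
  \<open>y - \<alpha> *\<^sub>R p\<close> minimizes the difference of these two bounds.\<close>

lemma gradient_cocoercive:
  fixes f :: "'a::real_inner \<Rightarrow> real"
  assumes "convex_fun (\<lambda>z. ereal (f z))" and "\<alpha> > 0"
    and G: "\<And>z. GDERIV f z :> gradf z"
    and L: "\<And>z z'. norm (gradf z - gradf z') \<le> (1 / \<alpha>) * norm (z - z')"
  shows "f z + inner (gradf z) (y - z) + \<alpha> / 2 * (norm (gradf y - gradf z))\<^sup>2 \<le> f y"
proof -
  define p where "p = gradf y - gradf z"
  have "f z + inner (gradf z) (y - \<alpha> *\<^sub>R p - z) \<le> f (y - \<alpha> *\<^sub>R p)"
    by (rule convex_fun_gradient_ineq[OF assms(1) G])
  moreover have "f (y - \<alpha> *\<^sub>R p) \<le> f y + inner (gradf y) (y - \<alpha> *\<^sub>R p - y)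
      + 1 / \<alpha> / 2 * (norm (y - \<alpha> *\<^sub>R p - y))\<^sup>2"
    by (rule descent_lemma[OF G L])
  moreover have "1 / \<alpha> / 2 * (norm (y - \<alpha> *\<^sub>R p - y))\<^sup>2 = \<alpha> / 2 * (norm p)\<^sup>2"
    using \<open>\<alpha> > 0\<close> by (simp add: power2_eq_square)
  moreover have "inner (gradf y) p - inner (gradf z) p = (norm p)\<^sup>2"
    by (simp add: p_def power2_norm_eq_inner inner_diff_left)
  then have "\<alpha> * inner (gradf y) p - \<alpha> * inner (gradf z) p = \<alpha> * (norm p)\<^sup>2"
    by (metis right_diff_distrib)
  ultimately show ?thesis by (simp add: inner_diff_right p_def[symmetric])
qed

section \<open>Conjugates, primal optimality and duality\<close>

lemma conjugate_ge: "ereal (inner zs z) - h z \<le> conjugate h zs"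
  unfolding conjugate_def by (rule SUP_upper) simp

text \<open>This is Fenchel-Young with a quadratic surplus. Instead of \<open>z\<close>, the
  supremum is tested at \<open>z + \<alpha> *\<^sub>R s\<close>, which maximizes the lower bound
  that the descent lemma at \<open>z\<close> gives for the objective.\<close>

lemma conjugate_smooth_ge:
  assumes "\<alpha> > 0"
    and "\<And>z. GDERIV f z :> gradf z"
    and "\<And>z z'. norm (gradf z - gradf z') \<le> (1 / \<alpha>) * norm (z - z')"
  shows "ereal (inner v z - f z + \<alpha> / 2 * (norm (v - gradf z))\<^sup>2)
    \<le> conjugate (\<lambda>z. ereal (f z)) v"
proof -
  define s where "s = v - gradf z"
  have "f (z + \<alpha> *\<^sub>R s) \<le> f z + inner (gradf z) (z + \<alpha> *\<^sub>R s - z)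
      + 1 / \<alpha> / 2 * (norm (z + \<alpha> *\<^sub>R s - z))\<^sup>2"
    by (rule descent_lemma[OF assms(2,3)])
  moreover have "1 / \<alpha> / 2 * (norm (z + \<alpha> *\<^sub>R s - z))\<^sup>2 = \<alpha> / 2 * (norm s)\<^sup>2"
    using \<open>\<alpha> > 0\<close> by (simp add: power2_eq_square)
  moreover have "inner v s - inner (gradf z) s = (norm s)\<^sup>2"
    by (simp add: s_def power2_norm_eq_inner inner_diff_left)
  then have "\<alpha> * inner v s - \<alpha> * inner (gradf z) s = \<alpha> * (norm s)\<^sup>2"
    by (metis right_diff_distrib)
  ultimately have "inner v z - f z + \<alpha> / 2 * (norm s)\<^sup>2
      \<le> inner v (z + \<alpha> *\<^sub>R s) - f (z + \<alpha> *\<^sub>R s)"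
    by (simp add: inner_add_right)
  then have "ereal (inner v z - f z + \<alpha> / 2 * (norm s)\<^sup>2)
      \<le> ereal (inner v (z + \<alpha> *\<^sub>R s)) - ereal (f (z + \<alpha> *\<^sub>R s))"
    by simp
  also have "\<dots> \<le> conjugate (\<lambda>z. ereal (f z)) v"
    by (rule conjugate_ge[where h = "\<lambda>z. ereal (f z)"])
  finally show ?thesis by (simp add: s_def)
qed

text \<open>Fermat's rule: the negative of \<open>transpose A *v gradf (A *v xs)\<close> is a
  subgradient of \<open>g\<close> at \<open>xs\<close>.\<close>

lemma primal_min_subgradient:
  fixes A :: "real^'n^'m"
  assumes "convex_fun g" "\<And>z. GDERIV f z :> gradf z"
    and min: "\<And>x. primal A f g xs \<le> primal A f g x"
    and g: "g xs = ereal r0" "g x = ereal r"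
  shows "r0 - inner (gradf (A *v xs)) (A *v (x - xs)) \<le> r"
proof -
  let ?d = "A *v (x - xs)"
  \<comment> \<open>Up to the constant \<open>r0\<close>, this is the primal objective along the
    segment with \<open>g\<close> replaced by its chord. It dominates the objective there and agrees
    with it at 0, so it inherits the minimum at 0.\<close>
  let ?\<phi> = "\<lambda>t. f (A *v xs + t *\<^sub>R ?d) + t * (r - r0)"
  have "0 \<le> inner (gradf (A *v xs)) ?d + (r - r0)"
  proof (rule DERIV_nonneg_at_right_min)
    have "((\<lambda>t. f (A *v xs + t *\<^sub>R ?d)) has_real_derivative inner (gradf (A *v xs)) ?d) (at 0)"
      using assms(2)[of "A *v xs"] by (intro GDERIV_along_line) simp
    then show "(?\<phi> has_real_derivative inner (gradf (A *v xs)) ?d + (r - r0)) (at 0)"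
      by (auto intro!: derivative_eq_intros)
  next
    fix t :: real
    assume t: "0 < t" "t \<le> 1"
    define y where "y = (1 - t) *\<^sub>R xs + t *\<^sub>R x"
    have "y = xs + t *\<^sub>R (x - xs)" by (simp add: y_def algebra_simps)
    then have Ay: "A *v y = A *v xs + t *\<^sub>R ?d"
      by (simp add: matrix_vector_right_distrib matrix_vector_mult_scaleR)
    have "ereal (f (A *v xs) + r0) \<le> primal A f g y"
      using min[of y] g by (simp add: primal_def)
    also have "\<dots> \<le> ereal (f (A *v y)) + ereal ((1 - t) * r0 + t * r)"
      unfolding primal_def y_def using t g
      by (intro add_left_mono convex_fun_ereal_le assms(1)) auto
    finally show "?\<phi> 0 \<le> ?\<phi> t" by (simp add: Ay algebra_simps)
  qed
  then show ?thesis by simp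
qed

text \<open>Weak duality with a quadratic surplus: the two Fenchel-Young bounds are added and their
  inner products cancel. At a primal minimizer the right-hand side is a concave quadratic in
  \<open>u\<close> with its peak at the negative gradient.\<close>

lemma dual_le:
  fixes A :: "real^'n^'m"
  assumes "\<alpha> > 0"
    and "\<And>z. GDERIV f z :> gradf z"
    and "\<And>z z'. norm (gradf z - gradf z') \<le> (1 / \<alpha>) * norm (z - z')"
    and "g x = ereal r"
  shows "dual A f g u \<le> ereal (f (A *v x) + r - \<alpha> / 2 * (norm (u + gradf (A *v x)))\<^sup>2)"
proof -
  have "ereal (inner (- u) (A *v x) - f (A *v x) + \<alpha> / 2 * (norm (- u - gradf (A *v x)))\<^sup>2)
      \<le> conjugate (\<lambda>z. ereal (f z)) (- u)"
    by (rule conjugate_smooth_ge[OF assms(1-3)])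
  moreover have "norm (- u - gradf (A *v x)) = norm (u + gradf (A *v x))"
    by (metis minus_add_distrib norm_minus_cancel uminus_add_conv_diff add.commute)
  moreover have "ereal (inner u (A *v x) - r) \<le> conjugate g (transpose A *v u)"
    using conjugate_ge[of "transpose A *v u" x g] assms(4) by (simp add: dot_lmul_matrix)
  ultimately show ?thesis unfolding dual_def
    by (cases "conjugate (\<lambda>z. ereal (f z)) (- u)"; cases "conjugate g (transpose A *v u)") auto
qed

text \<open>This is the strong duality half. The gradient inequality makes \<open>A *v xs\<close>
  attain the supremum in the conjugate of \<open>f\<close>, and the subgradient inequality makes
  \<open>xs\<close> attain the one for \<open>g\<close>.\<close>

lemma dual_at_neg_gradient_ge:
  fixes A :: "real^'n^'m"
  assumes "convex_fun (\<lambda>z. ereal (f z))" "\<And>z. GDERIV f z :> gradf z"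
    and "proper_fun g" "convex_fun g"
    and min: "\<And>x. primal A f g xs \<le> primal A f g x"
    and "g xs = ereal r0"
  shows "ereal (f (A *v xs) + r0) \<le> dual A f g (- gradf (A *v xs))"
proof -
  let ?w = "gradf (A *v xs)"
  have "conjugate (\<lambda>z. ereal (f z)) ?w \<le> ereal (inner ?w (A *v xs) - f (A *v xs))"
    unfolding conjugate_def
  proof (rule SUP_least)
    fix z
    show "ereal (inner ?w z) - ereal (f z) \<le> ereal (inner ?w (A *v xs) - f (A *v xs))"
      using convex_fun_gradient_ineq[OF assms(1) assms(2)[of "A *v xs"], of z]
      by (simp add: inner_diff_right)
  qed
  moreover have "conjugate g (transpose A *v (- ?w)) \<le> ereal (- inner ?w (A *v xs) - r0)"
    unfolding conjugate_def
  proof (rule SUP_least)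
    fix x
    show "ereal (inner (transpose A *v (- ?w)) x) - g x \<le> ereal (- inner ?w (A *v xs) - r0)"
    proof (cases "g x")
      case (real r)
      then show ?thesis
        using primal_min_subgradient[OF assms(4,2) min assms(6) real]
        by (simp add: dot_lmul_matrix matrix_vector_mult_diff_distrib inner_diff_right)
    next
      case MInf
      then show ?thesis using assms(3) by (simp add: proper_fun_def)
    qed simp
  qed
  ultimately show ?thesis unfolding dual_def
    by (cases "conjugate (\<lambda>z. ereal (f z)) ?w"; cases "conjugate g (transpose A *v (- ?w))") auto
qed

text \<open>The parallelogram law for \<open>u - v\<close> and \<open>w + v\<close>: their sum is
  \<open>u + w\<close> and their difference is -2 times
  \<open>v - (1/2) *\<^sub>R (u - w)\<close>.\<close>

lemma norm_midpoint_sum: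
  fixes u v w :: "'a::real_inner"
  shows "(norm (v - (1/2) *\<^sub>R (u - w)))\<^sup>2 + (norm (u + w))\<^sup>2 / 4
    = ((norm (u - v))\<^sup>2 + (norm (w + v))\<^sup>2) / 2"
  by (simp add: power2_norm_eq_inner inner_simps inner_commute field_simps)

section \<open>The dual maximizer and its enclosing ball\<close>

theorem theorem4p1:
  fixes A :: "real^'n^'m"
    and f :: "real^'m \<Rightarrow> real"
    and g :: "real^'n \<Rightarrow> ereal"
    and gradf :: "real^'m \<Rightarrow> real^'m"
    and \<alpha> :: real
  assumes "proper_fun (\<lambda>z. ereal (f z))" "closed_fun (\<lambda>z. ereal (f z))"
      "convex_fun (\<lambda>z. ereal (f z))"
    and "proper_fun g" "closed_fun g" "convex_fun g"
    and "\<alpha> > 0"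
    and "\<And>z. GDERIV f z :> gradf z"
    and "\<And>z z'. norm (gradf z - gradf z') \<le> (1 / \<alpha>) * norm (z - z')"
    and "\<exists>x. is_arg_min (primal A f g) (\<lambda>_. True) x"
  shows "(\<exists>!ustar. is_arg_max (dual A f g) (\<lambda>_. True) ustar) \<and>
    (\<forall>ustar. is_arg_max (dual A f g) (\<lambda>_. True) ustar \<longrightarrow>
      (\<forall>x \<in> eff_dom (primal A f g). \<forall>u \<in> eff_dom (\<lambda>v. - dual A f g v).
        ustar \<in> cball ((1/2) *\<^sub>R (u - gradf (A *v x)))
          (sqrt (real_of_ereal (primal A f g x - dual A f g u) / \<alpha>
                 - (norm (u + gradf (A *v x)))\<^sup>2 / 4))))"
proof -
  obtain xs where "is_arg_min (primal A f g) (\<lambda>_. True) xs" using assms(10) by blast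
  then have min: "primal A f g xs \<le> primal A f g x" for x
    by (simp add: is_arg_min_linorder)
  \<comment> \<open>A point of the domain of \<open>g\<close> keeps the minimal primal value below
    infinity, which together with properness makes \<open>g xs\<close> real.\<close>
  obtain z where "g z < \<infinity>" using assms(4) by (auto simp: proper_fun_def eff_dom_def)
  then have "primal A f g xs < \<infinity>"
    using min[of z] by (cases "g z") (auto simp: primal_def)
  moreover have "g xs \<noteq> -\<infinity>" using assms(4) by (simp add: proper_fun_def)
  ultimately obtain r0 where r0: "g xs = ereal r0"
    by (cases "g xs") (auto simp: primal_def)
  define us where "us = - gradf (A *v xs)"
  define p where "p = f (A *v xs) + r0"
  have ub: "dual A f g u \<le> ereal (p - \<alpha> / 2 * (norm (u - us))\<^sup>2)" for u
    using dual_le[where g = g, OF assms(7-9) r0] by (simp add: p_def us_def)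
  have lb: "ereal p \<le> dual A f g us"
    unfolding p_def us_def by (rule dual_at_neg_gradient_ge[OF assms(3,8,4,6) min r0])
  have max: "is_arg_max (dual A f g) (\<lambda>_. True) us"
    unfolding is_arg_max_linorder
  proof (intro conjI allI impI TrueI)
    fix u
    have "dual A f g u \<le> ereal (p - \<alpha> / 2 * (norm (u - us))\<^sup>2)" by (rule ub)
    also have "\<dots> \<le> ereal p" using \<open>\<alpha> > 0\<close> by simp
    also note lb
    finally show "dual A f g u \<le> dual A f g us" .
  qed
  have uniq: "u = us" if "is_arg_max (dual A f g) (\<lambda>_. True) u" for u
  proof -
    \<comment> \<open>Any maximizer reaches the level \<open>p\<close>, and the upper bound
      \<open>ub\<close> admits that only at its peak \<open>us\<close>.\<close>
    have "ereal p \<le> dual A f g u"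
      using that lb by (meson is_arg_max_linorder order_trans)
    also note ub
    finally have "\<alpha> / 2 * (norm (u - us))\<^sup>2 \<le> 0" by simp
    then show ?thesis using \<open>\<alpha> > 0\<close> by (simp add: mult_le_0_iff)
  qed
  have ball: "us \<in> cball ((1/2) *\<^sub>R (u - gradf (A *v x)))
      (sqrt (real_of_ereal (primal A f g x - dual A f g u) / \<alpha>
             - (norm (u + gradf (A *v x)))\<^sup>2 / 4))"
    if x: "x \<in> eff_dom (primal A f g)" and u: "u \<in> eff_dom (\<lambda>v. - dual A f g v)" for x u
  proof -
    let ?w = "gradf (A *v x)"
    have "g x \<noteq> -\<infinity>" using assms(4) by (simp add: proper_fun_def)
    then obtain r where r: "g x = ereal r"
      using x by (cases "g x") (auto simp: primal_def eff_dom_def)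
    have P: "primal A f g x = ereal (f (A *v x) + r)" by (simp add: primal_def r)
    \<comment> \<open>Membership in the domain of \<open>-D\<close> excludes the value minus
      infinity, and \<open>ub\<close> excludes plus infinity.\<close>
    obtain q where q: "dual A f g u = ereal q"
      using u ub[of u] by (cases "dual A f g u") (auto simp: eff_dom_def)
    \<comment> \<open>Quadratic growth of the primal: adding the subgradient inequality for
      \<open>g\<close> cancels the linear term at \<open>xs\<close>.\<close>
    have "f (A *v xs) + inner (gradf (A *v xs)) (A *v x - A *v xs)
        + \<alpha> / 2 * (norm (?w - gradf (A *v xs)))\<^sup>2 \<le> f (A *v x)"
      by (rule gradient_cocoercive[OF assms(3,7-9)])
    moreover have "r0 - inner (gradf (A *v xs)) (A *v (x - xs)) \<le> r"
      by (rule primal_min_subgradient[OF assms(6,8) min r0 r])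
    ultimately have "p + \<alpha> / 2 * (norm (?w + us))\<^sup>2 \<le> f (A *v x) + r"
      by (simp add: p_def us_def matrix_vector_mult_diff_distrib)
    moreover have "q \<le> p - \<alpha> / 2 * (norm (u - us))\<^sup>2" using ub[of u] q by simp
    \<comment> \<open>Adding primal growth and dual decay eliminates \<open>p\<close>, so only the
      duality gap at \<open>x\<close> and \<open>u\<close> remains.\<close>
    ultimately have "((norm (u - us))\<^sup>2 + (norm (?w + us))\<^sup>2) / 2 \<le> (f (A *v x) + r - q) / \<alpha>"
      using \<open>\<alpha> > 0\<close> by (simp add: pos_le_divide_eq algebra_simps)
    then have "(norm (us - (1/2) *\<^sub>R (u - ?w)))\<^sup>2
        \<le> (f (A *v x) + r - q) / \<alpha> - (norm (u + ?w))\<^sup>2 / 4"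
      using norm_midpoint_sum[of us u ?w] by linarith
    then have "norm (us - (1/2) *\<^sub>R (u - ?w))
        \<le> sqrt ((f (A *v x) + r - q) / \<alpha> - (norm (u + ?w))\<^sup>2 / 4)"
      by (rule real_le_rsqrt)
    then show ?thesis by (simp only: P q) (simp add: dist_norm norm_minus_commute)
  qed
  show ?thesis using max uniq ball by blast
qed

end
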